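(* Let $n\ge3$, let $b,x\in\mathbb{C}^*$, and let $\omega_1:VL_n\longrightarrow\mathrm{GL}_n(\mathbb{C})$ be the representation of the virtual triplet group given for $1\le i\le n-1$ by \[ \omega_1(\ell_i)=\begin{pmatrix} I_{i-1}&0&0\\ 0&\begin{pmatrix}0&b\\ \frac1b&0\end{pmatrix}&0\\ 0&0&I_{n-i-1}\end{pmatrix},\qquad \omega_1(\rho_i)=\begin{pmatrix} I_{i-1}&0&0\\ 0&\begin{pmatrix}0&x\\ \frac1x&0\end{pmatrix}&0\\ 0&0&I_{n-i-1}\end{pmatrix}. \] Then $\omega_1$ is irreducible if and only if $b\neq x$.
   Context: The virtual triplet group $VL_n$ is generated by $\ell_1,\ldots,\ell_{n-1},\rho_1,\ldots,\rho_{n-1}$ subject to: $\ell_i^2=1$ and $\rho_i^2=1$ ($1\le i\le n-1$); $\ell_i\ell_{i+1}\ell_i=\ell_{i+1}\ell_i\ell_{i+1}$ and $\rho_i\rho_{i+1}\rho_i=\rho_{i+1}\rho_i\rho_{i+1}$ ($1\le i\le n-2$); $\rho_i\rho_j=\rho_j\rho_i$ and $\ell_i\rho_j=\rho_j\ell_i$ ($|i-j|\ge2$); $\rho_i\rho_{i+1}\ell_i=\ell_{i+1}\rho_i\rho_{i+1}$ ($1\le i\le n-2$). (No commutation relations among the $\ell_i$ are imposed.) $I_r$ denotes the $r\times r$ identity matrix. Irreducible means that the only subspaces of $\mathbb{C}^n$ invariant under the image are $\{0\}$ and $\mathbb{C}^n$. *)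

theory Defs
  imports "Jordan_Normal_Form.VS_Connect" Complex_Main
begin

section \<open>Groups given by generators and relations\<close>

text \<open>
  A word is a list of signed letters, \<open>(s, True)\<close> standing for \<open>s\<close> and \<open>(s, False)\<close> for its
  inverse. The group with generators \<open>S\<close> and relations \<open>R\<close> consists of the classes of words
  over \<open>S\<close> modulo the least congruence for concatenation that contains the cancellations
  and the pairs in \<open>R\<close>.
\<close>

type_synonym 'g word = "('g \<times> bool) list"

definition words :: "'g set \<Rightarrow> 'g word set" where
  "words S = lists (S \<times> UNIV)"

inductive_set pres_rel :: "'g set \<Rightarrow> ('g word \<times> 'g word) set \<Rightarrow> ('g word \<times> 'g word) set"
  for S :: "'g set" and R :: "('g word \<times> 'g word) set" where
  refl: "u \<in> words S \<Longrightarrow> (u, u) \<in> pres_rel S R"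
| sym: "(u, v) \<in> pres_rel S R \<Longrightarrow> (v, u) \<in> pres_rel S R"
| trans: "(u, v) \<in> pres_rel S R \<Longrightarrow> (v, w) \<in> pres_rel S R \<Longrightarrow> (u, w) \<in> pres_rel S R"
| cancel: "u \<in> words S \<Longrightarrow> v \<in> words S \<Longrightarrow> s \<in> S \<Longrightarrow>
    (u @ [(s, e), (s, \<not> e)] @ v, u @ v) \<in> pres_rel S R"
| rel: "u \<in> words S \<Longrightarrow> v \<in> words S \<Longrightarrow> (p, q) \<in> R \<Longrightarrow> p \<in> words S \<Longrightarrow> q \<in> words S \<Longrightarrow>
    (u @ p @ v, u @ q @ v) \<in> pres_rel S R"

definition pres_class :: "'g set \<Rightarrow> ('g word \<times> 'g word) set \<Rightarrow> 'g word \<Rightarrow> 'g word set" where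
  "pres_class S R w = pres_rel S R `` {w}"

definition presented_group :: "'g set \<Rightarrow> ('g word \<times> 'g word) set \<Rightarrow> 'g word set monoid" where
  "presented_group S R =
    \<lparr>carrier = words S // pres_rel S R,
     monoid.mult = (\<lambda>A B. \<Union>u\<in>A. \<Union>v\<in>B. pres_class S R (u @ v)),
     one = pres_class S R []\<rparr>"

definition positive_word :: "'g list \<Rightarrow> 'g word" where
  "positive_word = map (\<lambda>s. (s, True))"

definition pres_gen :: "'g set \<Rightarrow> ('g word \<times> 'g word) set \<Rightarrow> 'g \<Rightarrow> 'g word set" where
  "pres_gen S R s = pres_class S R (positive_word [s])"


section \<open>The virtual triplet group\<close>

datatype vl_letter = Ell nat | Rho nat

definition vl_letters :: "nat \<Rightarrow> vl_letter set" where
  "vl_letters n = Ell ` {1..n - 1} \<union> Rho ` {1..n - 1}"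

definition vl_relations :: "nat \<Rightarrow> (vl_letter list \<times> vl_letter list) set" where
  "vl_relations n =
     {([Ell i, Ell i], []) | i. i \<in> {1..n - 1}} \<union>
     {([Rho i, Rho i], []) | i. i \<in> {1..n - 1}} \<union>
     {([Ell i, Ell (i + 1), Ell i], [Ell (i + 1), Ell i, Ell (i + 1)]) | i. i \<in> {1..n - 2}} \<union>
     {([Rho i, Rho (i + 1), Rho i], [Rho (i + 1), Rho i, Rho (i + 1)]) | i. i \<in> {1..n - 2}} \<union>
     {([Rho i, Rho j], [Rho j, Rho i]) | i j.
        i \<in> {1..n - 1} \<and> j \<in> {1..n - 1} \<and> \<bar>int i - int j\<bar> \<ge> 2} \<union>
     {([Ell i, Rho j], [Rho j, Ell i]) | i j.
        i \<in> {1..n - 1} \<and> j \<in> {1..n - 1} \<and> \<bar>int i - int j\<bar> \<ge> 2} \<union>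
     {([Rho i, Rho (i + 1), Ell i], [Ell (i + 1), Rho i, Rho (i + 1)]) | i. i \<in> {1..n - 2}}"

abbreviation vl_signed_relations :: "nat \<Rightarrow> (vl_letter word \<times> vl_letter word) set" where
  "vl_signed_relations n \<equiv> map_prod positive_word positive_word ` vl_relations n"

definition VL :: "nat \<Rightarrow> vl_letter word set monoid" where
  "VL n = presented_group (vl_letters n) (vl_signed_relations n)"

definition vl_ell :: "nat \<Rightarrow> nat \<Rightarrow> vl_letter word set" where
  "vl_ell n i = pres_gen (vl_letters n) (vl_signed_relations n) (Ell i)"

definition vl_rho :: "nat \<Rightarrow> nat \<Rightarrow> vl_letter word set" where
  "vl_rho n i = pres_gen (vl_letters n) (vl_signed_relations n) (Rho i)"


section \<open>Complex representations\<close>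

definition GL :: "nat \<Rightarrow> complex mat monoid" where
  "GL n = units_of (ring_mat TYPE(complex) n ())"

text \<open>With this convention the zero representation (\<open>n = 0\<close>) counts as irreducible.\<close>

definition irreducible_rep :: "('g, 'm) monoid_scheme \<Rightarrow> nat \<Rightarrow> ('g \<Rightarrow> complex mat) \<Rightarrow> bool" where
  "irreducible_rep G n \<omega> \<longleftrightarrow>
     (\<forall>W. VectorSpace.subspace class_ring W (module_vec TYPE(complex) n) \<and>
          (\<forall>g\<in>carrier G. \<forall>w\<in>W. \<omega> g *\<^sub>v w \<in> W) \<longrightarrow>
          W = {0\<^sub>v n} \<or> W = carrier_vec n)"

definition antidiag_block :: "nat \<Rightarrow> nat \<Rightarrow> complex \<Rightarrow> complex mat" where
  "antidiag_block n i a =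
     diag_block_mat [1\<^sub>m (i - 1), mat_of_rows_list 2 [[0, a], [1 / a, 0]], 1\<^sub>m (n - i - 1)]"


section \<open>The group axioms and the existence of the representation\<close>

text \<open>
  Nothing below enters the definitions above. The lemmas \<open>group_presented_group\<close> and \<open>omega1_exists\<close>
  show that \<open>VL n\<close> is a group and that the prescribed images of the generators extend to a
  homomorphism, so that a hypothesis asking for such a homomorphism is never vacuous.
\<close>

lemma pres_rel_words: "(u, v) \<in> pres_rel S R \<Longrightarrow> u \<in> words S \<and> v \<in> words S"
  by (induction rule: pres_rel.induct) (auto simp: words_def)

lemma equiv_pres_rel: "equiv (words S) (pres_rel S R)"
  by (intro equivI refl_onI symI transI)
     (auto intro: pres_rel.intros dest: pres_rel_words)

lemma pres_rel_context:
  assumes "(u, v) \<in> pres_rel S R" "p \<in> words S" "q \<in> words S"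
  shows "(p @ u @ q, p @ v @ q) \<in> pres_rel S R"
  using assms
proof (induction rule: pres_rel.induct)
  case (refl u)
  then show ?case by (intro pres_rel.refl) (auto simp: words_def)
next
  case (sym u v)
  then show ?case by (blast intro: pres_rel.sym)
next
  case (trans u v w)
  then show ?case by (blast intro: pres_rel.trans)
next
  case (cancel u v s e)
  have "((p @ u) @ [(s, e), (s, \<not> e)] @ (v @ q), (p @ u) @ (v @ q)) \<in> pres_rel S R"
    using cancel by (intro pres_rel.cancel) (auto simp: words_def)
  then show ?case by simp
next
  case (rel u v r t)
  have "((p @ u) @ r @ (v @ q), (p @ u) @ t @ (v @ q)) \<in> pres_rel S R"
    using rel by (intro pres_rel.rel) (auto simp: words_def)
  then show ?case by simp
qed

lemma pres_rel_append:
  assumes "(u, u') \<in> pres_rel S R" "(v, v') \<in> pres_rel S R"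
  shows "(u @ v, u' @ v') \<in> pres_rel S R"
proof -
  have "[] \<in> words S" by (simp add: words_def)
  moreover have "u' \<in> words S" "v \<in> words S" using assms pres_rel_words by blast+
  ultimately have "([] @ u @ v, [] @ u' @ v) \<in> pres_rel S R" "(u' @ v @ [], u' @ v' @ []) \<in> pres_rel S R"
    using assms by (blast intro: pres_rel_context)+
  then show ?thesis by (simp add: pres_rel.trans[of "u @ v" "u' @ v"])
qed

lemma pres_class_eq_iff:
  "u \<in> words S \<Longrightarrow> v \<in> words S \<Longrightarrow>
    pres_class S R u = pres_class S R v \<longleftrightarrow> (u, v) \<in> pres_rel S R"
  unfolding pres_class_def by (rule eq_equiv_class_iff[OF equiv_pres_rel])

lemma carrier_presented_group: "carrier (presented_group S R) = pres_class S R ` words S"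
  by (auto simp: presented_group_def quotient_def pres_class_def)

lemma mult_presented_group:
  assumes "u \<in> words S" "v \<in> words S"
  shows "pres_class S R u \<otimes>\<^bsub>presented_group S R\<^esub> pres_class S R v = pres_class S R (u @ v)"
proof -
  have *: "pres_class S R (u' @ v') = pres_class S R (u @ v)"
    if "u' \<in> pres_class S R u" "v' \<in> pres_class S R v" for u' v'
  proof -
    have r: "(u @ v, u' @ v') \<in> pres_rel S R"
      using that by (intro pres_rel_append) (auto simp: pres_class_def)
    then show ?thesis
      using pres_class_eq_iff[of "u' @ v'" S "u @ v" R] pres_rel_words[OF r] pres_rel.sym[OF r]
      by blast
  qed
  have "u \<in> pres_class S R u" "v \<in> pres_class S R v"
    using assms by (auto simp: pres_class_def intro: pres_rel.refl)
  then have "(\<Union>u'\<in>pres_class S R u. \<Union>v'\<in>pres_class S R v. pres_class S R (u' @ v')) =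
      pres_class S R (u @ v)"
    using * by blast
  then show ?thesis by (simp add: presented_group_def)
qed

lemma one_presented_group: "\<one>\<^bsub>presented_group S R\<^esub> = pres_class S R []"
  by (simp add: presented_group_def)

lemma append_words: "u \<in> words S \<Longrightarrow> v \<in> words S \<Longrightarrow> u @ v \<in> words S"
  and Nil_words: "[] \<in> words S"
  by (auto simp: words_def)

lemma left_inverse_word:
  assumes "u \<in> words S"
  shows "\<exists>v\<in>words S. (v @ u, []) \<in> pres_rel S R"
  using assms
proof (induction u)
  case Nil
  show ?case by (rule bexI[of _ "[]"]) (auto simp: words_def intro: pres_rel.refl)
next
  case (Cons a u)
  obtain s e where a: "a = (s, e)" by force
  have u: "u \<in> words S" and s: "s \<in> S" using Cons.prems a by (auto simp: words_def)
  then obtain v where v: "v \<in> words S" "(v @ u, []) \<in> pres_rel S R" using Cons.IH by blast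
  have "(v @ [(s, \<not> e), (s, \<not> \<not> e)] @ u, v @ u) \<in> pres_rel S R"
    using u v s by (intro pres_rel.cancel)
  then have "((v @ [(s, \<not> e)]) @ a # u, []) \<in> pres_rel S R"
    using v(2) by (auto simp: a intro: pres_rel.trans)
  moreover have "v @ [(s, \<not> e)] \<in> words S" using v s by (auto simp: words_def)
  ultimately show ?case by blast
qed

lemma group_presented_group: "group (presented_group S R)"
proof (rule groupI)
  fix A assume "A \<in> carrier (presented_group S R)"
  then obtain u where u: "u \<in> words S" "A = pres_class S R u"
    by (auto simp: carrier_presented_group)
  obtain v where v: "v \<in> words S" "(v @ u, []) \<in> pres_rel S R"
    using left_inverse_word[OF u(1)] by blast
  have "pres_class S R v \<otimes>\<^bsub>presented_group S R\<^esub> A = \<one>\<^bsub>presented_group S R\<^esub>"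
    using u v by (simp add: mult_presented_group one_presented_group append_words Nil_words
        pres_class_eq_iff)
  then show "\<exists>B\<in>carrier (presented_group S R).
      B \<otimes>\<^bsub>presented_group S R\<^esub> A = \<one>\<^bsub>presented_group S R\<^esub>"
    using v(1) by (auto simp: carrier_presented_group)
qed (auto simp: carrier_presented_group mult_presented_group one_presented_group append_words Nil_words)

definition word_value :: "('a, 'm) monoid_scheme \<Rightarrow> ('g \<Rightarrow> 'a) \<Rightarrow> 'g word \<Rightarrow> 'a" where
  "word_value H f w =
    foldr (\<lambda>(s, e) a. (if e then f s else inv\<^bsub>H\<^esub> f s) \<otimes>\<^bsub>H\<^esub> a) w \<one>\<^bsub>H\<^esub>"

lemma (in group) word_value_closed:
  assumes "f \<in> S \<rightarrow> carrier G" "u \<in> words S"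
  shows "word_value G f u \<in> carrier G"
  using assms(2) by (induction u) (use funcset_mem[OF assms(1)] in \<open>auto simp: word_value_def words_def\<close>)

lemma (in group) word_value_append:
  assumes "f \<in> S \<rightarrow> carrier G" "u \<in> words S" "v \<in> words S"
  shows "word_value G f (u @ v) = word_value G f u \<otimes> word_value G f v"
  using assms(2)
proof (induction u)
  case Nil
  then show ?case using word_value_closed[OF assms(1,3)] by (simp add: word_value_def)
next
  case (Cons a u)
  obtain s e where a: "a = (s, e)" by force
  have u: "u \<in> words S" and s: "f s \<in> carrier G"
    using Cons.prems a assms(1) by (auto simp: words_def)
  show ?case
    using Cons.IH[OF u] s word_value_closed[OF assms(1) u] word_value_closed[OF assms(1,3)]
    by (simp add: a word_value_def m_assoc)
qed

lemma (in group) word_value_cong: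
  assumes f: "f \<in> S \<rightarrow> carrier G"
    and R: "\<And>p q. (p, q) \<in> R \<Longrightarrow> word_value G f p = word_value G f q"
    and "(u, v) \<in> pres_rel S R"
  shows "word_value G f u = word_value G f v"
  using assms(3)
proof (induction rule: pres_rel.induct)
  case (cancel u v s e)
  have s: "f s \<in> carrier G" using f cancel by auto
  have w: "[(s, e), (s, \<not> e)] \<in> words S" using cancel by (simp add: words_def)
  have "word_value G f [(s, e), (s, \<not> e)] = \<one>" using s by (simp add: word_value_def)
  then show ?case
    using cancel w word_value_closed[OF f]
    by (simp add: word_value_append[OF f] append_words del: append_Cons append_Nil)
next
  case (rel u v p q)
  then show ?case by (simp add: word_value_append[OF f] append_words R)
qed auto

lemma presented_group_lift:
  assumes "group H" and f: "f \<in> S \<rightarrow> carrier H"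
    and R: "\<And>p q. (p, q) \<in> R \<Longrightarrow> word_value H f p = word_value H f q"
  shows "\<exists>h\<in>hom (presented_group S R) H. \<forall>s\<in>S. h (pres_gen S R s) = f s"
proof -
  interpret group H by fact
  define h where "h A = word_value H f (SOME w. w \<in> A)" for A
  have h: "h (pres_class S R u) = word_value H f u" if u: "u \<in> words S" for u
  proof -
    have "u \<in> pres_class S R u" using u by (auto simp: pres_class_def intro: pres_rel.refl)
    then have "(SOME w. w \<in> pres_class S R u) \<in> pres_class S R u" by (rule someI)
    then have "(u, SOME w. w \<in> pres_class S R u) \<in> pres_rel S R" by (simp add: pres_class_def)
    then show ?thesis unfolding h_def using word_value_cong[OF f R] by metis
  qed
  have "h \<in> hom (presented_group S R) H"
    by (rule homI)
       (auto simp: carrier_presented_group mult_presented_group h append_words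
         word_value_append[OF f] word_value_closed[OF f])
  moreover have "h (pres_gen S R s) = f s" if "s \<in> S" for s
  proof -
    have "positive_word [s] \<in> words S" "f s \<in> carrier H"
      using that f by (auto simp: words_def positive_word_def)
    then show ?thesis by (simp add: pres_gen_def h) (simp add: positive_word_def word_value_def)
  qed
  ultimately show ?thesis by blast
qed

lemma antidiag_block_carrier: "1 \<le> i \<Longrightarrow> i < n \<Longrightarrow> antidiag_block n i a \<in> carrier_mat n n"
  by (rule carrier_matI) (auto simp: antidiag_block_def dim_diag_block_mat mat_of_rows_list_def)

lemma antidiag_block_four_block:
  "antidiag_block (k + (2 + m)) (Suc k) a =
    four_block_mat (1\<^sub>m k) (0\<^sub>m k (2 + m)) (0\<^sub>m (2 + m) k)
      (four_block_mat (mat_of_rows_list 2 [[0, a], [1 / a, 0]]) (0\<^sub>m 2 m) (0\<^sub>m m 2) (1\<^sub>m m))"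
proof -
  have "four_block_mat (1\<^sub>m m) (0\<^sub>m m 0) (0\<^sub>m 0 m) (0\<^sub>m 0 0) = (1\<^sub>m m :: complex mat)"
    by (rule eq_matI) auto
  then show ?thesis
    by (simp add: antidiag_block_def Let_def mat_of_rows_list_def numeral_2_eq_2)
qed
lemma antidiag_inner_index: "r < Suc (Suc m) \<Longrightarrow> c < Suc (Suc m) \<Longrightarrow>
  four_block_mat (mat_of_rows_list 2 [[0, a], [1 / a, 0]]) (0\<^sub>m 2 m) (0\<^sub>m m 2) (1\<^sub>m m) $$ (r,c) =
   (if r = 0 then (if c = 1 then a else 0) else if r = 1 then (if c = 0 then 1 / (a::complex) else 0) else if r = c then 1 else 0)"
  by (cases r; cases "r - 1"; cases c; cases "c - 1"; simp add: mat_of_rows_list_def )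

lemma antidiag_block_index:
  assumes "1 \<le> i" "i < n" "r < n" "c < n"
  shows "antidiag_block n i a $$ (r, c) =
    (if r = i - 1 then (if c = i then a else 0)
     else if r = i then (if c = i - 1 then 1 / a else 0)
     else if r = c then 1 else 0)"
proof -
  obtain k where k: "i = Suc k" using assms(1) by (cases i) auto
  define m where "m = n - i - 1"
  have n: "n = k + (2 + m)" using assms k by (simp add: m_def)
  let ?B = "four_block_mat (mat_of_rows_list 2 [[0, a], [1 / a, 0]]) (0\<^sub>m 2 m) (0\<^sub>m m 2) (1\<^sub>m m)"
  have d: "dim_row (mat_of_rows_list 2 [[0, a], [1 / a, 0]]) = 2"
    "dim_col (mat_of_rows_list 2 [[0, a], [1 / a, 0]]) = 2"
    by (simp_all add: mat_of_rows_list_def)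
  have *: "antidiag_block n i a $$ (r, c) =
    (if r < k then if c < k then 1\<^sub>m k $$ (r, c) else 0
     else if c < k then 0 else ?B $$ (r - k, c - k))"
    using assms(3,4) unfolding n k antidiag_block_four_block
    by (subst index_mat_four_block) (simp_all add: d)
  show ?thesis
  proof (cases "k \<le> r \<and> k \<le> c")
    case True
    then obtain r' c' where rc: "r = k + r'" "c = k + c'" by (meson nat_le_iff_add)
    have "r' < Suc (Suc m)" "c' < Suc (Suc m)" using assms(3,4) n rc by auto
    from antidiag_inner_index[OF this] show ?thesis unfolding * unfolding rc k by simp
  next
    case False
    then show ?thesis unfolding * unfolding k by auto
  qed
qed

lemma antidiag_block_mult_index:
  assumes i: "1 \<le> i" "i < n" and A: "A \<in> carrier_mat n n" and rc: "r < n" "c < n"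
  shows "(antidiag_block n i a * A) $$ (r, c) =
    (if r = i - 1 then a * A $$ (i, c)
     else if r = i then A $$ (i - 1, c) / a
     else A $$ (r, c))"
proof -
  have D: "antidiag_block n i a \<in> carrier_mat n n" using i by (rule antidiag_block_carrier)
  have "(antidiag_block n i a * A) $$ (r, c) =
      (\<Sum>k\<in>{0..<n}. antidiag_block n i a $$ (r, k) * A $$ (k, c))"
    using A D rc by (auto simp: scalar_prod_def intro!: sum.cong)
  also have "\<dots> = (\<Sum>k\<in>{0..<n}.
      if k = (if r = i - 1 then i else if r = i then i - 1 else r)
      then (if r = i - 1 then a else if r = i then 1 / a else 1) * A $$ (k, c) else 0)"
    using i rc by (intro sum.cong refl) (auto simp: antidiag_block_index)
  also have "\<dots> = (if r = i - 1 then a else if r = i then 1 / a else 1) *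
      A $$ (if r = i - 1 then i else if r = i then i - 1 else r, c)"
    using i rc by (subst sum.delta) auto
  finally show ?thesis by auto
qed

lemma antidiag_block_square:
  assumes "1 \<le> i" "i < n" "a \<noteq> 0"
  shows "antidiag_block n i a * antidiag_block n i a = 1\<^sub>m n"
proof -
  obtain k where k: "i = Suc k" using assms(1) by (cases i) auto
  show ?thesis
  proof (rule eq_matI)
    fix r c assume "r < dim_row (1\<^sub>m n :: complex mat)" "c < dim_col (1\<^sub>m n :: complex mat)"
    then have "r < n" "c < n" by auto
    with assms show "(antidiag_block n i a * antidiag_block n i a) $$ (r, c) = 1\<^sub>m n $$ (r, c)"
      by (simp add: k antidiag_block_mult_index antidiag_block_carrier antidiag_block_index
          del: index_mult_mat(1))
  qed (use assms antidiag_block_carrier in auto)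
qed

lemma antidiag_block_commute:
  assumes "1 \<le> i" "i < n" "1 \<le> j" "j < n" "\<bar>int i - int j\<bar> \<ge> 2"
  shows "antidiag_block n i a * antidiag_block n j c = antidiag_block n j c * antidiag_block n i a"
proof -
  obtain k l where k: "i = Suc k" "j = Suc l" using assms by (cases i; cases j) auto
  have ne: "k \<noteq> l" "Suc k \<noteq> l" "k \<noteq> Suc l" using assms(5) k by auto
  show ?thesis
  proof (rule eq_matI)
    fix r s assume "r < dim_row (antidiag_block n j c * antidiag_block n i a)"
      "s < dim_col (antidiag_block n j c * antidiag_block n i a)"
    then have "r < n" "s < n"
      using antidiag_block_carrier[OF assms(1,2), of a] antidiag_block_carrier[OF assms(3,4), of c]
      by auto
    with assms(1-4) ne ne[symmetric] show "(antidiag_block n i a * antidiag_block n j c) $$ (r, s) =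
        (antidiag_block n j c * antidiag_block n i a) $$ (r, s)"
      by (simp add: k antidiag_block_mult_index antidiag_block_carrier antidiag_block_index
          del: index_mult_mat(1))
  qed (use assms antidiag_block_carrier[of i n a] antidiag_block_carrier[of j n c] in auto)
qed

lemma antidiag_block_braid:
  assumes "1 \<le> i" "i + 1 < n" "a \<noteq> 0" "c \<noteq> 0"
  shows "antidiag_block n i a * (antidiag_block n (i + 1) a * antidiag_block n i c) =
         antidiag_block n (i + 1) c * (antidiag_block n i a * antidiag_block n (i + 1) a)"
proof -
  obtain k where k: "i = Suc k" using assms(1) by (cases i) auto
  have car: "antidiag_block n (Suc k) d \<in> carrier_mat n n"
    "antidiag_block n (Suc (Suc k)) d \<in> carrier_mat n n" for d
    using assms k by (intro antidiag_block_carrier; simp)+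
  note dims = car[THEN carrier_matD(1)] car[THEN carrier_matD(2)]
  note car' = mult_carrier_mat[OF car(1) car(2)] mult_carrier_mat[OF car(2) car(1)]
  show ?thesis
  proof (rule eq_matI)
    fix r s
    assume "r < dim_row (antidiag_block n (i + 1) c * (antidiag_block n i a * antidiag_block n (i + 1) a))"
      "s < dim_col (antidiag_block n (i + 1) c * (antidiag_block n i a * antidiag_block n (i + 1) a))"
    then have "r < n" "s < n" using k by (simp_all add: dims)
    moreover have "r = k \<or> r = Suc k \<or> r = Suc (Suc k) \<or> r \<noteq> k \<and> r \<noteq> Suc k \<and> r \<noteq> Suc (Suc k)"
      "s = k \<or> s = Suc k \<or> s = Suc (Suc k) \<or> s \<noteq> k \<and> s \<noteq> Suc k \<and> s \<noteq> Suc (Suc k)" by blast+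
    ultimately show "(antidiag_block n i a * (antidiag_block n (i + 1) a * antidiag_block n i c))
          $$ (r, s) =
        (antidiag_block n (i + 1) c * (antidiag_block n i a * antidiag_block n (i + 1) a))
          $$ (r, s)"
      using assms
      by (elim disjE) (simp_all add: k antidiag_block_mult_index car car' antidiag_block_index
          del: index_mult_mat(1))
  qed (use k in \<open>simp_all add: dims\<close>)
qed

lemma group_GL: "group (GL n)"
  unfolding GL_def
  by (intro monoid.units_group ring.is_monoid) (simp add: ring_mat)

lemma antidiag_block_GL:
  assumes "1 \<le> i" "i < n" "a \<noteq> 0"
  shows "antidiag_block n i a \<in> carrier (GL n)"
  using antidiag_block_carrier[OF assms(1,2), of a] antidiag_block_square[OF assms]
  by (auto simp: GL_def units_of_def Units_def ring_mat_simps)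

lemma GL_simps: "x \<otimes>\<^bsub>GL n\<^esub> y = x * y" "\<one>\<^bsub>GL n\<^esub> = 1\<^sub>m n"
  by (simp_all add: GL_def units_of_def ring_mat_simps)

lemma index_range: "{1..n - 1} = {i. 1 \<le> i \<and> i < (n :: nat)}" "{1..n - 2} = {i. 1 \<le> i \<and> i + 1 < (n :: nat)}"
  by auto

lemma omega1_exists:
  fixes b x :: complex
  assumes "b \<noteq> 0" "x \<noteq> 0"
  shows "\<exists>\<omega>\<in>hom (VL n) (GL n). \<forall>i\<in>{1..n - 1}.
    \<omega> (vl_ell n i) = antidiag_block n i b \<and> \<omega> (vl_rho n i) = antidiag_block n i x"
proof -
  define f where "f s = (case s of Ell i \<Rightarrow> antidiag_block n i b | Rho i \<Rightarrow> antidiag_block n i x)"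
    for s
  have f: "f \<in> vl_letters n \<rightarrow> carrier (GL n)"
  proof (rule funcsetI)
    fix s assume "s \<in> vl_letters n"
    then obtain i where i: "1 \<le> i" "i < n" and "s = Ell i \<or> s = Rho i"
      unfolding vl_letters_def index_range by blast
    with assms show "f s \<in> carrier (GL n)"
      using antidiag_block_GL[OF i] by (auto simp: f_def)
  qed
  have "word_value (GL n) f p = word_value (GL n) f q" if pq_rel: "(p, q) \<in> vl_signed_relations n" for p q
  proof -
    have car: "f s \<in> carrier_mat n n" if "s \<in> vl_letters n" for s
      using funcset_mem[OF f that] by (simp add: GL_def units_of_def Units_def ring_mat_simps)
    have v0: "word_value (GL n) f (positive_word []) = 1\<^sub>m n"
      by (simp add: word_value_def positive_word_def GL_simps)
    have v2: "word_value (GL n) f (positive_word [s, t]) = f s * f t"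
      if "s \<in> vl_letters n" "t \<in> vl_letters n" for s t
      using car[OF that(2)]
      by (simp add: word_value_def positive_word_def GL_simps right_mult_one_mat)
    have v3: "word_value (GL n) f (positive_word [s, t, u]) = f s * (f t * f u)"
      if "s \<in> vl_letters n" "t \<in> vl_letters n" "u \<in> vl_letters n" for s t u
      using car[OF that(3)]
      by (simp add: word_value_def positive_word_def GL_simps right_mult_one_mat)
    have mem: "Ell i \<in> vl_letters n" "Rho i \<in> vl_letters n" if "1 \<le> i" "i < n" for i
      using that unfolding vl_letters_def index_range by blast+
    have fs: "f (Ell i) = antidiag_block n i b" "f (Rho i) = antidiag_block n i x" for i
      by (simp_all add: f_def)
    obtain p' q' where pq: "p = positive_word p'" "q = positive_word q'"
      and "(p', q') \<in> vl_relations n" using pq_rel by auto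
    have rel: "(p', q') \<in> vl_relations n" by fact
    have "word_value (GL n) f (positive_word p') = word_value (GL n) f (positive_word q')"
      using rel unfolding vl_relations_def index_range
    proof (elim UnE CollectE exE conjE, goal_cases)
      case (1 i)
      then have "p' = [Ell i, Ell i]" "q' = []" by blast+
      with 1 show ?case
        by (simp only: v0 v2 mem fs antidiag_block_square[OF _ _ assms(1)])
    next
      case (2 i)
      then have "p' = [Rho i, Rho i]" "q' = []" by blast+
      with 2 show ?case
        by (simp only: v0 v2 mem fs antidiag_block_square[OF _ _ assms(2)])
    next
      case (3 i)
      then have "1 \<le> i + 1" "i < n"
        "p' = [Ell i, Ell (i + 1), Ell i]" "q' = [Ell (i + 1), Ell i, Ell (i + 1)]" by auto
      with 3 antidiag_block_braid[of i n b b] assms show ?case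
        by (simp only: v3 mem fs not_False_eq_True)
    next
      case (4 i)
      then have "1 \<le> i + 1" "i < n"
        "p' = [Rho i, Rho (i + 1), Rho i]" "q' = [Rho (i + 1), Rho i, Rho (i + 1)]" by auto
      with 4 antidiag_block_braid[of i n x x] assms show ?case
        by (simp only: v3 mem fs not_False_eq_True)
    next
      case (5 i j)
      then have "p' = [Rho i, Rho j]" "q' = [Rho j, Rho i]" by blast+
      with 5 show ?case
        by (simp only: v2 mem fs antidiag_block_commute[of i n j x x])
    next
      case (6 i j)
      then have "p' = [Ell i, Rho j]" "q' = [Rho j, Ell i]" by blast+
      with 6 show ?case
        by (simp only: v2 mem fs antidiag_block_commute[of i n j b x])
    next
      case (7 i)
      then have "1 \<le> i + 1" "i < n"
        "p' = [Rho i, Rho (i + 1), Ell i]" "q' = [Ell (i + 1), Rho i, Rho (i + 1)]" by auto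
      with 7 antidiag_block_braid[of i n x b] assms show ?case
        by (simp only: v3 mem fs not_False_eq_True)
    qed
    then show ?thesis by (simp only: pq)
  qed
  from presented_group_lift[OF group_GL f this]
  obtain h where "h \<in> hom (VL n) (GL n)" and
    h: "\<And>s. s \<in> vl_letters n \<Longrightarrow>
      h (pres_gen (vl_letters n) (vl_signed_relations n) s) = f s"
    unfolding VL_def by blast
  moreover have "Ell i \<in> vl_letters n" "Rho i \<in> vl_letters n" if "i \<in> {1..n - 1}" for i
    using that by (auto simp: vl_letters_def)
  ultimately show ?thesis
    by (intro bexI[of _ h]) (auto simp: vl_ell_def vl_rho_def f_def)
qed

end

theory Submission
  imports Defs
begin

text \<open>
  Every generator acts on \<open>\<complex>\<^sup>n\<close> by exchanging two adjacent coordinates, up to the scalars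
  \<open>a\<close> and \<open>1 / a\<close>, where \<open>a\<close> is \<open>b\<close> or \<open>x\<close>. Coordinates are numbered from 0, so that the
  generators of index \<open>i\<close> exchange the coordinates \<open>i - 1\<close> and \<open>i\<close>.

  If \<open>b = x\<close>, the two families of generators have the same images, and the vector
  \<open>(1, 1/x, 1/x\<^sup>2, \<dots>)\<close> is fixed by all of them. Its coordinates satisfy
  \<open>v\<^sub>i\<^sub>-\<^sub>1 = x v\<^sub>i\<close>, and the solutions of these equations form an invariant subspace that
  contains \<open>v\<close> but not the first unit vector.

  If \<open>b \<noteq> x\<close>, the product of the two generators of index \<open>i\<close> acts as the diagonal matrix with entries
  \<open>b/x\<close> and \<open>x/b\<close> at \<open>i - 1\<close> and \<open>i\<close>, and \<open>1\<close> elsewhere. Subtracting the identity gives a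
  diagonal matrix with exactly two non-zero entries, and the product of these matrices for two
  consecutive indices is a non-zero multiple of the projection to the coordinate that they share
  (\<open>isolate_common_coordinate\<close>). This is where \<open>n \<ge> 3\<close> enters: two consecutive indices must exist.
  For \<open>n = 2\<close> the statement fails at \<open>b = - x\<close>, where the product of the two generators is
  \<open>-1\<close>. Since the generators permute the coordinate axes transitively, an invariant
  subspace with a non-zero vector contains a vector that does not vanish at the shared coordinate,
  hence one unit vector, hence all of them.
\<close>

section \<open>Action of the blocks on vectors\<close>

lemma antidiag_block_mult_vec_index:
  assumes i: "1 \<le> i" "i < n" and v: "v \<in> carrier_vec n" and r: "r < n"
  shows "(antidiag_block n i a *\<^sub>v v) $ r =
    (if r = i - 1 then a * v $ i else if r = i then v $ (i - 1) / a else v $ r)"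
proof -
  have D: "antidiag_block n i a \<in> carrier_mat n n" using i by (rule antidiag_block_carrier)
  have "(antidiag_block n i a *\<^sub>v v) $ r = (\<Sum>k\<in>{0..<n}. antidiag_block n i a $$ (r, k) * v $ k)"
    using D v r by (auto simp: scalar_prod_def intro!: sum.cong)
  also have "\<dots> = (\<Sum>k\<in>{0..<n}.
      if k = (if r = i - 1 then i else if r = i then i - 1 else r)
      then (if r = i - 1 then a else if r = i then 1 / a else 1) * v $ k else 0)"
    using i r by (intro sum.cong refl) (auto simp: antidiag_block_index)
  also have "\<dots> = (if r = i - 1 then a else if r = i then 1 / a else 1) *
      v $ (if r = i - 1 then i else if r = i then i - 1 else r)"
    using i r by (subst sum.delta) auto
  finally show ?thesis by auto
qed

lemma antidiag_block_mult_vec_carrier: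
  assumes "1 \<le> i" "i < n" "v \<in> carrier_vec n"
  shows "antidiag_block n i a *\<^sub>v v \<in> carrier_vec n"
  using antidiag_block_carrier[OF assms(1,2)] assms(3) by (rule mult_mat_vec_carrier)

lemma antidiag_block_unit_vec:
  assumes "1 \<le> i" "i < n"
  shows "antidiag_block n i a *\<^sub>v unit_vec n i = a \<cdot>\<^sub>v unit_vec n (i - 1)"
    and "antidiag_block n i a *\<^sub>v unit_vec n (i - 1) = (1 / a) \<cdot>\<^sub>v unit_vec n i"
  using assms antidiag_block_carrier[OF assms, of a]
  by (auto intro!: eq_vecI simp: antidiag_block_mult_vec_index simp del: index_mult_mat_vec)

lemma antidiag_block_fixes:
  assumes i: "1 \<le> i" "i < n" and a: "a \<noteq> 0" and v: "v \<in> carrier_vec n"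
    and eq: "v $ (i - 1) = a * v $ i"
  shows "antidiag_block n i a *\<^sub>v v = v"
  using i a v eq antidiag_block_carrier[OF i, of a]
  by (intro eq_vecI) (auto simp: antidiag_block_mult_vec_index simp del: index_mult_mat_vec)

lemma antidiag_block_product_index:
  assumes i: "1 \<le> i" "i < n" and v: "v \<in> carrier_vec n" and r: "r < n"
  shows "(antidiag_block n i b *\<^sub>v (antidiag_block n i x *\<^sub>v v)) $ r =
    (if r = i - 1 then b / x * v $ r else if r = i then x / b * v $ r else v $ r)"
  using i r v by (auto simp: antidiag_block_mult_vec_index antidiag_block_mult_vec_carrier
      simp del: index_mult_mat_vec)


section \<open>Subspaces of coordinate space\<close>

lemma subspace_vecD:
  assumes "VectorSpace.subspace class_ring W (module_vec TYPE(complex) n)"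
  shows "W \<subseteq> carrier_vec n" "0\<^sub>v n \<in> W"
    and "\<And>v w. v \<in> W \<Longrightarrow> w \<in> W \<Longrightarrow> v + w \<in> W"
    and "\<And>c v. v \<in> W \<Longrightarrow> c \<cdot>\<^sub>v v \<in> W"
proof -
  have *: "submodule class_ring W (module_vec TYPE(complex) n)"
    using assms by (simp add: VectorSpace.subspace_def)
  show "W \<subseteq> carrier_vec n" "0\<^sub>v n \<in> W"
    and "\<And>v w. v \<in> W \<Longrightarrow> w \<in> W \<Longrightarrow> v + w \<in> W"
    and "\<And>c v. v \<in> W \<Longrightarrow> c \<cdot>\<^sub>v v \<in> W"
    using submodule.subset[OF *] submodule.zero_closed[OF *] submodule.m_closed[OF *]
      submodule.smult_closed[OF *]
    by (auto simp: module_vec_simps class_ring_simps)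
qed

lemma subspace_vecI:
  assumes "W \<subseteq> carrier_vec n" "0\<^sub>v n \<in> W"
    and "\<And>v w. v \<in> W \<Longrightarrow> w \<in> W \<Longrightarrow> v + w \<in> W"
    and "\<And>c v. v \<in> W \<Longrightarrow> c \<cdot>\<^sub>v v \<in> W"
  shows "VectorSpace.subspace class_ring W (module_vec TYPE(complex) n)"
  unfolding VectorSpace.subspace_def submodule_def
  using assms by (auto simp: module_vec_simps class_ring_simps vec_vs vec_module)

lemma subspace_vec_smult_cancel:
  assumes "VectorSpace.subspace class_ring W (module_vec TYPE(complex) n)"
    and "c \<cdot>\<^sub>v v \<in> W" "c \<noteq> 0"
  shows "v \<in> W"
  using subspace_vecD(4)[OF assms(1,2), of "1 / c"] assms(3) by (simp add: smult_smult_assoc)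

lemma subspace_vec_diff:
  assumes "VectorSpace.subspace class_ring W (module_vec TYPE(complex) n)"
    and "v \<in> W" "w \<in> W"
  shows "v - w \<in> W"
proof -
  have "v \<in> carrier_vec n" "w \<in> carrier_vec n" using subspace_vecD(1)[OF assms(1)] assms by auto
  then have "v - w = v + (-1) \<cdot>\<^sub>v w" by (intro eq_vecI) auto
  then show ?thesis using subspace_vecD(3,4)[OF assms(1)] assms by simp
qed

text \<open>Induction over the truncations of a vector replaces the expansion in the standard basis.\<close>

lemma subspace_with_unit_vecs_is_carrier:
  assumes W: "VectorSpace.subspace class_ring W (module_vec TYPE(complex) n)"
    and e: "\<And>k. k < n \<Longrightarrow> unit_vec n k \<in> W"
  shows "W = carrier_vec n"
proof
  show "W \<subseteq> carrier_vec n" by (rule subspace_vecD(1)[OF W])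
  show "carrier_vec n \<subseteq> W"
  proof
    fix v :: "complex vec" assume v: "v \<in> carrier_vec n"
    have trunc: "vec n (\<lambda>r. if r < k then v $ r else 0) \<in> W" if "k \<le> n" for k
      using that
    proof (induction k)
      case 0
      have "vec n (\<lambda>r. if r < 0 then v $ r else 0) = 0\<^sub>v n" by (intro eq_vecI) auto
      then show ?case using subspace_vecD(2)[OF W] by simp
    next
      case (Suc k)
      have "vec n (\<lambda>r. if r < Suc k then v $ r else 0) =
          vec n (\<lambda>r. if r < k then v $ r else 0) + (v $ k) \<cdot>\<^sub>v unit_vec n k"
        using Suc.prems by (intro eq_vecI) (auto simp: less_Suc_eq)
      then show ?case
        using Suc subspace_vecD(3,4)[OF W] e[of k] by simp
    qed
    have "vec n (\<lambda>r. if r < n then v $ r else 0) = v" using v by (intro eq_vecI) auto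
    then show "v \<in> W" using trunc[of n] by simp
  qed
qed


section \<open>Transitivity on the coordinates\<close>

lemma adjacent_closed_all:
  fixes P :: "nat \<Rightarrow> bool"
  assumes adj: "\<And>i. 1 \<le> i \<Longrightarrow> i < n \<Longrightarrow> P (i - 1) \<longleftrightarrow> P i"
    and "P j" "j < n" "k < n"
  shows "P k"
proof -
  have "P m \<longleftrightarrow> P 0" if "m < n" for m
    using that by (induction m) (use adj[of "Suc _"] in auto)
  with assms(2-4) show ?thesis by blast
qed

text \<open>
  One family of generators suffices for transitivity: the block of index \<open>i\<close> carries a vector that is
  non-zero at one of the coordinates \<open>i - 1\<close> and \<open>i\<close> to a vector that is non-zero at the other.
\<close>

lemma invariant_subspace_nonzero_coordinate:
  assumes "W \<subseteq> carrier_vec n" and a: "a \<noteq> 0"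
    and inv: "\<And>i w. 1 \<le> i \<Longrightarrow> i < n \<Longrightarrow> w \<in> W \<Longrightarrow> antidiag_block n i a *\<^sub>v w \<in> W"
    and w: "w \<in> W" "w \<noteq> 0\<^sub>v n" and k: "k < n"
  shows "\<exists>u\<in>W. u $ k \<noteq> 0"
proof -
  have "w \<in> carrier_vec n" using w assms(1) by auto
  have "\<exists>j<n. w $ j \<noteq> 0"
  proof (rule ccontr)
    assume "\<not> (\<exists>j<n. w $ j \<noteq> 0)"
    then have "w = 0\<^sub>v n" using \<open>w \<in> carrier_vec n\<close> by (intro eq_vecI) auto
    with w show False by simp
  qed
  then obtain j where j: "j < n" "\<exists>u\<in>W. u $ j \<noteq> 0" using w by blast
  have adj: "(\<exists>u\<in>W. u $ (i - 1) \<noteq> 0) \<longleftrightarrow> (\<exists>u\<in>W. u $ i \<noteq> 0)" if i: "1 \<le> i" "i < n" for i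
  proof -
    have swap: "(antidiag_block n i a *\<^sub>v u) $ (i - 1) = a * u $ i"
      "(antidiag_block n i a *\<^sub>v u) $ i = u $ (i - 1) / a" if "u \<in> W" for u
      using antidiag_block_mult_vec_index[OF i, of u "i - 1" a]
        antidiag_block_mult_vec_index[OF i, of u i a] that assms(1) i by force+
    show ?thesis
    proof
      assume "\<exists>u\<in>W. u $ (i - 1) \<noteq> 0"
      then obtain u where u: "u \<in> W" "u $ (i - 1) \<noteq> 0" by blast
      show "\<exists>u\<in>W. u $ i \<noteq> 0"
        using inv[OF i u(1)] swap(2)[OF u(1)] u(2) a by (intro bexI) auto
    next
      assume "\<exists>u\<in>W. u $ i \<noteq> 0"
      then obtain u where u: "u \<in> W" "u $ i \<noteq> 0" by blast
      show "\<exists>u\<in>W. u $ (i - 1) \<noteq> 0"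
        using inv[OF i u(1)] swap(1)[OF u(1)] u(2) a by (intro bexI) auto
    qed
  qed
  show ?thesis by (rule adjacent_closed_all[of n "\<lambda>k. \<exists>u\<in>W. u $ k \<noteq> 0", OF adj j(2,1) k])
qed

lemma invariant_subspace_unit_vec:
  assumes W: "VectorSpace.subspace class_ring W (module_vec TYPE(complex) n)" and a: "a \<noteq> 0"
    and inv: "\<And>i w. 1 \<le> i \<Longrightarrow> i < n \<Longrightarrow> w \<in> W \<Longrightarrow> antidiag_block n i a *\<^sub>v w \<in> W"
    and j: "j < n" "unit_vec n j \<in> W"
  shows "W = carrier_vec n"
proof (rule subspace_with_unit_vecs_is_carrier[OF W])
  fix k assume k: "k < n"
  have adj: "unit_vec n (i - 1) \<in> W \<longleftrightarrow> unit_vec n i \<in> W" if i: "1 \<le> i" "i < n" for i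
  proof
    assume "unit_vec n (i - 1) \<in> W"
    from inv[OF i this] show "unit_vec n i \<in> W"
      unfolding antidiag_block_unit_vec[OF i] by (rule subspace_vec_smult_cancel[OF W]) (simp add: a)
  next
    assume "unit_vec n i \<in> W"
    from inv[OF i this] show "unit_vec n (i - 1) \<in> W"
      unfolding antidiag_block_unit_vec[OF i] by (rule subspace_vec_smult_cancel[OF W]) (rule a)
  qed
  show "unit_vec n k \<in> W"
    by (rule adjacent_closed_all[of n "\<lambda>k. unit_vec n k \<in> W", OF adj j(2,1) k])
qed


section \<open>Isolating one coordinate\<close>

text \<open>
  With \<open>D\<^sub>i\<close> the product of the two generators of index \<open>i\<close>, the matrix \<open>D\<^sub>i - 1\<close> is diagonal with
  support \<open>{i - 1, i}\<close>, and \<open>D\<^sub>i\<^sub>+\<^sub>1 - 1\<close> has support \<open>{i, i + 1}\<close>. Applying both leaves only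
  coordinate \<open>i\<close>, multiplied by \<open>(x/b - 1)(b/x - 1)\<close>.
\<close>

lemma isolate_common_coordinate:
  assumes W: "VectorSpace.subspace class_ring W (module_vec TYPE(complex) n)"
    and bx: "b \<noteq> 0" "x \<noteq> 0" "b \<noteq> x"
    and invb: "\<And>i w. 1 \<le> i \<Longrightarrow> i < n \<Longrightarrow> w \<in> W \<Longrightarrow> antidiag_block n i b *\<^sub>v w \<in> W"
    and invx: "\<And>i w. 1 \<le> i \<Longrightarrow> i < n \<Longrightarrow> w \<in> W \<Longrightarrow> antidiag_block n i x *\<^sub>v w \<in> W"
    and i: "1 \<le> i" "i + 1 < n" and w: "w \<in> W" "w $ i \<noteq> 0"
  shows "unit_vec n i \<in> W"
proof -
  define T where "T k v = antidiag_block n k b *\<^sub>v (antidiag_block n k x *\<^sub>v v) - v" for k v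
  have T: "T k v \<in> W" if "1 \<le> k" "k < n" "v \<in> W" for k v
    unfolding T_def using that by (intro subspace_vec_diff[OF W] invb invx)
  have T_index: "T k v $ r =
      (if r = k - 1 then (b / x - 1) * v $ r else if r = k then (x / b - 1) * v $ r else 0)"
    if "1 \<le> k" "k < n" "v \<in> W" "r < n" for k v r
  proof -
    have v: "v \<in> carrier_vec n" using that subspace_vecD(1)[OF W] by auto
    have "T k v $ r = (antidiag_block n k b *\<^sub>v (antidiag_block n k x *\<^sub>v v)) $ r - v $ r"
      unfolding T_def using v that by (intro index_minus_vec) auto
    then show ?thesis
      using antidiag_block_product_index[OF that(1,2) v that(4), of b x]
      by (auto simp: algebra_simps)
  qed
  have i': "i < n" "1 \<le> i + 1" using i by auto
  define u where "u = T (i + 1) (T i w)"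
  have u: "u \<in> W" unfolding u_def using i i' w by (intro T)
  define c where "c = (b / x - 1) * (x / b - 1) * w $ i"
  have "c \<noteq> 0" using bx w by (simp add: c_def)
  have "u \<in> carrier_vec n" using u subspace_vecD(1)[OF W] by auto
  then have "u = c \<cdot>\<^sub>v unit_vec n i"
    using i i' w by (intro eq_vecI) (auto simp: u_def c_def T_index T)
  with u \<open>c \<noteq> 0\<close> show ?thesis using subspace_vec_smult_cancel[OF W] by simp
qed

lemma invariant_subspace_trivial:
  assumes W: "VectorSpace.subspace class_ring W (module_vec TYPE(complex) n)"
    and n: "n \<ge> 3" and bx: "b \<noteq> 0" "x \<noteq> 0" "b \<noteq> x"
    and invb: "\<And>i w. 1 \<le> i \<Longrightarrow> i < n \<Longrightarrow> w \<in> W \<Longrightarrow> antidiag_block n i b *\<^sub>v w \<in> W"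
    and invx: "\<And>i w. 1 \<le> i \<Longrightarrow> i < n \<Longrightarrow> w \<in> W \<Longrightarrow> antidiag_block n i x *\<^sub>v w \<in> W"
  shows "W = {0\<^sub>v n} \<or> W = carrier_vec n"
proof (cases "W = {0\<^sub>v n}")
  case False
  then obtain w where w: "w \<in> W" "w \<noteq> 0\<^sub>v n" using subspace_vecD(2)[OF W] by blast
  \<comment> \<open>Coordinate 1 is shared by the generators of indices 1 and 2.\<close>
  obtain u where u: "u \<in> W" "u $ 1 \<noteq> 0"
    using invariant_subspace_nonzero_coordinate[OF subspace_vecD(1)[OF W] bx(2) invx w, of 1] n
    by auto
  have "unit_vec n 1 \<in> W"
    using n by (intro isolate_common_coordinate[OF W bx invb invx _ _ u]) auto
  then show ?thesis using invariant_subspace_unit_vec[OF W bx(2) invx, of 1] n by auto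
qed simp


section \<open>Vectors fixed by a linear group given by generators\<close>

text \<open>
  A generator and its inverse fix the same vectors, so a vector fixed by the generators is fixed by
  the value of every signed word.
\<close>

lemma fixed_vector_presented_group:
  assumes h: "h \<in> hom (presented_group S R) (GL n)"
    and v: "v \<in> carrier_vec n"
    and gen: "\<And>s. s \<in> S \<Longrightarrow> h (pres_gen S R s) *\<^sub>v v = v"
    and g: "g \<in> carrier (presented_group S R)"
  shows "h g *\<^sub>v v = v"
proof -
  let ?c = "pres_class S R"
  have car: "h (?c u) \<in> carrier_mat n n" if "u \<in> words S" for u
    using hom_in_carrier[OF h, of "?c u"] that
    by (simp add: carrier_presented_group GL_def units_of_def Units_def ring_mat_simps)
  have mult: "h (?c (u @ u')) = h (?c u) * h (?c u')" if "u \<in> words S" "u' \<in> words S" for u u'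
    using hom_mult[OF h, of "?c u" "?c u'"] that
    by (simp add: carrier_presented_group mult_presented_group GL_simps)
  have one: "h (?c []) = 1\<^sub>m n"
    using hom_one[OF h group_presented_group group_GL] by (simp add: one_presented_group GL_simps)
  have letter: "h (?c [(s, e)]) *\<^sub>v v = v" if s: "s \<in> S" for s e
  proof (cases e)
    case True
    then show ?thesis using gen[OF s] by (simp add: pres_gen_def positive_word_def)
  next
    case False
    have w: "[(s, d)] \<in> words S" for d using s by (simp add: words_def)
    have "([] @ [(s, False), (s, \<not> False)] @ [], [] @ []) \<in> pres_rel S R"
      using s by (intro pres_rel.cancel) (auto simp: Nil_words)
    then have "?c ([(s, False)] @ [(s, True)]) = ?c []"
      using append_words[OF w w] by (subst pres_class_eq_iff) (auto simp: Nil_words)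
    then have inv: "h (?c [(s, False)]) * h (?c [(s, True)]) = 1\<^sub>m n"
      using mult[OF w w] one by metis
    have "h (?c [(s, True)]) *\<^sub>v v = v" using gen[OF s] by (simp add: pres_gen_def positive_word_def)
    then have "h (?c [(s, False)]) *\<^sub>v v = h (?c [(s, False)]) *\<^sub>v (h (?c [(s, True)]) *\<^sub>v v)"
      by simp
    also have "\<dots> = (h (?c [(s, False)]) * h (?c [(s, True)])) *\<^sub>v v"
      using assoc_mult_mat_vec[OF car[OF w] car[OF w] v] by simp
    also have "\<dots> = v" using inv v by simp
    finally show ?thesis using False by simp
  qed
  obtain u where u: "u \<in> words S" "g = ?c u" using g by (auto simp: carrier_presented_group)
  have "h (?c u) *\<^sub>v v = v" using u(1)
  proof (induction u)
    case Nil
    then show ?case using one v by simp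
  next
    case (Cons a u)
    obtain s e where a: "a = (s, e)" by force
    have u: "u \<in> words S" and s: "s \<in> S" and w: "[a] \<in> words S"
      using Cons.prems a by (auto simp: words_def)
    have "h (?c (a # u)) = h (?c [a]) * h (?c u)" using mult[OF w u] by simp
    then show ?case
      using assoc_mult_mat_vec[OF car[OF w] car[OF u] v] Cons.IH[OF u] letter[OF s, of e] a by simp
  qed
  with u show ?thesis by simp
qed


section \<open>The irreducibility criterion\<close>

lemma vl_gen_carrier:
  assumes "i \<in> {1..n - 1}"
  shows "vl_ell n i \<in> carrier (VL n)" "vl_rho n i \<in> carrier (VL n)"
  using assms
  by (auto simp: VL_def vl_ell_def vl_rho_def pres_gen_def carrier_presented_group vl_letters_def
      words_def positive_word_def)

lemma reducible_if_equal:
  fixes x :: complex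
  assumes n: "n \<ge> 2" and x: "x \<noteq> 0" and \<omega>: "\<omega> \<in> hom (VL n) (GL n)"
    and ell: "\<And>i. i \<in> {1..n - 1} \<Longrightarrow> \<omega> (vl_ell n i) = antidiag_block n i x"
    and rho: "\<And>i. i \<in> {1..n - 1} \<Longrightarrow> \<omega> (vl_rho n i) = antidiag_block n i x"
  shows "\<not> irreducible_rep (VL n) n \<omega>"
proof
  \<comment> \<open>The equations say that every generator fixes \<open>v\<close>.\<close>
  define W where "W = {v \<in> carrier_vec n. \<forall>i\<in>{1..n - 1}. v $ (i - 1) = x * v $ i}"
  have fixed: "\<omega> g *\<^sub>v w = w" if g: "g \<in> carrier (VL n)" and w: "w \<in> W" for g w
  proof (rule fixed_vector_presented_group[OF \<omega>[unfolded VL_def] _ _ g[unfolded VL_def]])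
    show wc: "w \<in> carrier_vec n" using w by (simp add: W_def)
    fix s assume "s \<in> vl_letters n"
    then obtain i where i: "i \<in> {1..n - 1}" and s: "s = Ell i \<or> s = Rho i"
      by (auto simp: vl_letters_def)
    have "antidiag_block n i x *\<^sub>v w = w"
      using i w by (intro antidiag_block_fixes x wc) (auto simp: W_def)
    then show "\<omega> (pres_gen (vl_letters n) (vl_signed_relations n) s) *\<^sub>v w = w"
      using s ell[OF i] rho[OF i] by (auto simp: vl_ell_def vl_rho_def)
  qed
  assume "irreducible_rep (VL n) n \<omega>"
  moreover have "VectorSpace.subspace class_ring W (module_vec TYPE(complex) n)"
    by (rule subspace_vecI) (auto simp: W_def algebra_simps)
  ultimately have triv: "W = {0\<^sub>v n} \<or> W = carrier_vec n"
    using fixed unfolding irreducible_rep_def by simp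
  have "vec n (\<lambda>k. inverse x ^ k) \<in> W"
    using x by (auto simp: W_def power_eq_if)
  moreover have "vec n (\<lambda>k. inverse x ^ k) \<noteq> 0\<^sub>v n"
    using n by (auto dest!: arg_cong[of _ _ "\<lambda>v. v $ 0"])
  moreover have "unit_vec n 0 \<notin> W"
    using n by (auto simp: W_def intro!: bexI[of _ 1])
  moreover have "unit_vec n 0 \<in> (carrier_vec n :: complex vec set)" by simp
  ultimately show False using triv by blast
qed

theorem theorem26:
  fixes n :: nat and b x :: complex and \<omega> :: "vl_letter word set \<Rightarrow> complex mat"
  assumes "n \<ge> 3" and "b \<noteq> 0" and "x \<noteq> 0"
    and "\<omega> \<in> hom (VL n) (GL n)"
    and "\<And>i. i \<in> {1..n - 1} \<Longrightarrow> \<omega> (vl_ell n i) = antidiag_block n i b"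
    and "\<And>i. i \<in> {1..n - 1} \<Longrightarrow> \<omega> (vl_rho n i) = antidiag_block n i x"
  shows "irreducible_rep (VL n) n \<omega> \<longleftrightarrow> b \<noteq> x"
proof
  assume irr: "irreducible_rep (VL n) n \<omega>"
  show "b \<noteq> x"
  proof
    assume "b = x"
    then have "\<not> irreducible_rep (VL n) n \<omega>"
      using reducible_if_equal[of n x \<omega>] assms by simp
    with irr show False by simp
  qed
next
  assume bx: "b \<noteq> x"
  show "irreducible_rep (VL n) n \<omega>"
    unfolding irreducible_rep_def
  proof (intro allI impI, elim conjE)
    fix W
    assume W: "VectorSpace.subspace class_ring W (module_vec TYPE(complex) n)"
      and inv: "\<forall>g\<in>carrier (VL n). \<forall>w\<in>W. \<omega> g *\<^sub>v w \<in> W"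
    have "antidiag_block n i b *\<^sub>v w \<in> W" "antidiag_block n i x *\<^sub>v w \<in> W"
      if "1 \<le> i" "i < n" "w \<in> W" for i w
    proof -
      have i: "i \<in> {1..n - 1}" using that by auto
      show "antidiag_block n i b *\<^sub>v w \<in> W" "antidiag_block n i x *\<^sub>v w \<in> W"
        using inv vl_gen_carrier[OF i] assms(5,6)[OF i] \<open>w \<in> W\<close> by metis+
    qed
    then show "W = {0\<^sub>v n} \<or> W = carrier_vec n"
      by (intro invariant_subspace_trivial[OF W assms(1-3) bx])
  qed
qed

end
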